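(* Let $n=2m$ and let $f\colon \mathbb{F}_2^{m-1}\times\mathbb{F}_2^{m+1}\to\mathbb{F}_2$ be defined by $$f(x,y)=x\cdot\phi(y)+h(y),\qquad x\in\mathbb{F}_2^{m-1},\ y\in\mathbb{F}_2^{m+1},$$ where $\phi\colon\mathbb{F}_2^{m+1}\to\mathbb{F}_2^{m-1}$ and $h\colon\mathbb{F}_2^{m+1}\to\mathbb{F}_2$. For $a\in\mathbb{F}_2^{m-1}$ put $\phi^{-1}(a)=\{y\in\mathbb{F}_2^{m+1}\mid\phi(y)=a\}$. Then $f$ is a bent function if and only if both of the following hold: (i) the collection $\{\phi^{-1}(a)\mid a\in\mathbb{F}_2^{m-1}\}$ is a partition of $\mathbb{F}_2^{m+1}$ into $2$-dimensional affine subspaces; and (ii) for every $a\in\mathbb{F}_2^{m-1}$, the restriction of $h$ to the set $\phi^{-1}(a)$ has odd weight.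
   Context: $m$ is a positive integer. "$\cdot$" is the standard dot product over $\mathbb{F}_2$. For $f\colon\mathbb{F}_2^n\to\mathbb{F}_2$, the Walsh-Hadamard transform is the integer-valued function $W_f(\omega)=\sum_{x\in\mathbb{F}_2^n}(-1)^{f(x)+\omega\cdot x}$. For $n$ even, $f$ is bent if $W_f(\omega)=\pm2^{n/2}$ for all $\omega\in\mathbb{F}_2^n$. $\mathbb{F}_2^{m-1}\times\mathbb{F}_2^{m+1}$ is identified with $\mathbb{F}_2^{2m}$. The weight of a Boolean function restricted to a set is the number of points of the set at which it takes the value $1$. *)

theory Defs
  imports
    "HOL-Library.Z2"
    "HOL-Library.Disjoint_Sets"
    "Jordan_Normal_Form.VS_Connect"
begin

text \<open>
  The field with two elements is the type \<^typ>\<open>bit\<close>. Since the dimensions \<open>m - 1\<close>, \<open>m + 1\<close>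
  and \<open>2 * m\<close> are related to each other and \<open>m - 1\<close> may be \<open>0\<close>, the space of dimension \<open>n\<close>
  over it is \<open>carrier_vec n\<close>. A Boolean function in \<open>n\<close> variables is a function on
  \<^typ>\<open>bit vec\<close>, of which only the values on \<open>carrier_vec n\<close> matter.
\<close>

definition walsh_hadamard :: "nat \<Rightarrow> (bit vec \<Rightarrow> bit) \<Rightarrow> bit vec \<Rightarrow> int" where
  "walsh_hadamard n f \<omega> =
     (\<Sum>x\<in>carrier_vec n. (- 1) ^ (of_bit (f x + \<omega> \<bullet> x) :: nat))"

definition bent :: "nat \<Rightarrow> (bit vec \<Rightarrow> bit) \<Rightarrow> bool" where
  "bent n f \<longleftrightarrow> even n \<and>
     (\<forall>\<omega>\<in>carrier_vec n.
        walsh_hadamard n f \<omega> = 2 ^ (n div 2) \<or> walsh_hadamard n f \<omega> = - (2 ^ (n div 2)))"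

text \<open>A \<open>d\<close>-dimensional affine subspace is a translate of a \<open>d\<close>-dimensional linear subspace;
  in particular it is nonempty.\<close>

definition affine_subspace :: "nat \<Rightarrow> nat \<Rightarrow> bit vec set \<Rightarrow> bool" where
  "affine_subspace n d A \<longleftrightarrow>
     (\<exists>v\<in>carrier_vec n. \<exists>W.
        subspace class_ring W (module_vec TYPE(bit) n) \<and>
        vectorspace.dim class_ring ((module_vec TYPE(bit) n)\<lparr>carrier := W\<rparr>) = d \<and>
        A = (\<lambda>w. v + w) ` W)"

definition fiber :: "nat \<Rightarrow> (bit vec \<Rightarrow> bit vec) \<Rightarrow> bit vec \<Rightarrow> bit vec set" where
  "fiber n \<phi> a = {y \<in> carrier_vec n. \<phi> y = a}"

definition weight_on :: "bit vec set \<Rightarrow> (bit vec \<Rightarrow> bit) \<Rightarrow> nat" where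
  "weight_on S h = card {y \<in> S. h y = 1}"

end

theory Submission
  imports Defs
begin

text \<open>
  Summing over \<open>x\<close> first, orthogonality of characters gives
  \<open>W\<^sub>f(a,b) = 2\<^bsup>m-1\<^esup> S\<^sub>a(b)\<close>, where \<open>S\<^sub>a(b)\<close> is the sum of \<open>(-1)\<^bsup>h(y) + b\<cdot>y\<^esup>\<close> over the
  fibre of \<open>a\<close>. Hence \<open>f\<close> is bent iff all \<open>S\<^sub>a(b)\<close> are \<open>\<plusminus>2\<close>. By Parseval's identity this forces
  every fibre to have exactly four points. A sum of four signs is \<open>\<plusminus>2\<close> iff their product is \<open>-1\<close>,
  which for the points \<open>p, q, r, s\<close> of a fibre says
  \<open>h(p) + h(q) + h(r) + h(s) + b\<cdot>(p + q + r + s) = 1\<close>. For all \<open>b\<close> simultaneously this means that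
  \<open>h\<close> has odd weight on the fibre and that \<open>p + q + r + s = 0\<close>, and four distinct points with sum
  zero are the same as an affine plane.
\<close>

text \<open>These simp rules turn sums and products of bits into bit operations, which escape
  ring reasoning.\<close>
declare add_bit_eq_xor [simp del] mult_bit_eq_and [simp del]

section \<open>Vectors over the field with two elements\<close>

lemma bit_add_self [simp]: "x + x = 0" for x :: bit
  by (cases x) auto

lemma bit_vec_add_eq_zero_iff:
  fixes x y :: "bit vec"
  assumes "x \<in> carrier_vec n" "y \<in> carrier_vec n"
  shows "x + y = 0\<^sub>v n \<longleftrightarrow> x = y"
proof
  assume *: "x + y = 0\<^sub>v n"
  show "x = y"
  proof (rule eq_vecI)
    fix i assume "i < dim_vec y"
    then have "(x + y) $ i = 0" unfolding * using assms by simp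
    then show "x $ i = y $ i"
      using \<open>i < dim_vec y\<close> by (cases "x $ i"; cases "y $ i") auto
  qed (use assms in auto)
qed (use assms in auto)

lemma bit_vec_add_self_left:
  fixes x y :: "bit vec"
  assumes "x \<in> carrier_vec n" "y \<in> carrier_vec n"
  shows "x + (x + y) = y"
  using assms by (intro eq_vecI) auto

text \<open>Splitting off the first coordinate drives the inductions on the dimension, both for
  finiteness of the space and for the evaluation of character sums.\<close>

lemma carrier_vec_Suc_eq: "carrier_vec (Suc n) = (\<lambda>(a, v). vCons a v) ` (UNIV \<times> carrier_vec n)"
proof -
  have "x \<in> (\<lambda>(a, v). vCons a v) ` (UNIV \<times> carrier_vec n)" if "x \<in> carrier_vec (Suc n)" for x :: "'a vec"
    using that by (cases x) force+
  then show ?thesis by auto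
qed

lemma UNIV_bit: "(UNIV :: bit set) = {0, 1}"
  by (auto intro: bit.exhaust)

lemma finite_carrier_bit_vec [simp]: "finite (carrier_vec n :: bit vec set)"
proof (induction n)
  case 0
  have "carrier_vec 0 \<subseteq> {vNil :: bit vec}" by auto
  then show ?case using finite_subset by blast
qed (simp add: carrier_vec_Suc_eq UNIV_bit)

section \<open>Two-dimensional linear subspaces\<close>

lemma (in vec_space) lincomb_pair:
  assumes "u \<in> carrier_vec n" "w \<in> carrier_vec n" "u \<noteq> w"
  shows "lincomb c {u, w} = c u \<cdot>\<^sub>v u + c w \<cdot>\<^sub>v w"
  using assms by (intro eq_vecI) (auto simp: lincomb_index lincomb_dim)

lemma span_bit_pair:
  fixes u w :: "bit vec"
  assumes u: "u \<in> carrier_vec n" and w: "w \<in> carrier_vec n" and "u \<noteq> w"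
  shows "LinearCombinations.module.span class_ring (module_vec TYPE(bit) n) {u, w} = {0\<^sub>v n, u, w, u + w}"
proof -
  interpret V: vec_space "TYPE(bit)" n .
  have "V.span {u, w} = {V.lincomb c {u, w} | c. True}"
    using V.finite_span[of "{u, w}"] u w by simp
  also have "\<dots> = {a \<cdot>\<^sub>v u + b \<cdot>\<^sub>v w | a b. True}" 
  proof -
    \<comment> \<open>Since \<open>u\<close> and \<open>w\<close> differ, one coefficient function
      can take prescribed values at both.\<close>
    have "\<exists>c. a = c u \<and> b = c w" for a b :: bit
      by (rule exI[of _ "\<lambda>x. if x = u then a else b"]) (use assms in auto)
    then show ?thesis
      unfolding V.lincomb_pair[OF assms] by (auto; metis)
  qed
  also have "\<dots> = {0\<^sub>v n, u, w, u + w}"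
  proof -
    have "(\<exists>a b. x = a \<cdot>\<^sub>v u + b \<cdot>\<^sub>v w) \<longleftrightarrow> x \<in> {0\<^sub>v n, u, w, u + w}" for x
    proof -
      have ex: "(\<exists>a. P a) \<longleftrightarrow> P 0 \<or> P 1" for P :: "bit \<Rightarrow> bool"
        by (metis bit.exhaust)
      show ?thesis unfolding ex using u w by auto
    qed
    then show ?thesis by auto
  qed
  finally show ?thesis .
qed

text \<open>Coefficients are 0 or 1, so a nontrivial relation would be \<open>u = 0\<close>,
  \<open>w = 0\<close> or \<open>u + w = 0\<close>, and the last one means
  \<open>u = w\<close>.\<close>

lemma lin_indpt_bit_pair:
  fixes u w :: "bit vec"
  assumes u: "u \<in> carrier_vec n" and w: "w \<in> carrier_vec n" and "u \<noteq> w" "u \<noteq> 0\<^sub>v n" "w \<noteq> 0\<^sub>v n"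
  shows "\<not> LinearCombinations.module.lin_dep class_ring (module_vec TYPE(bit) n) {u, w}"
proof -
  interpret V: vec_space "TYPE(bit)" n .
  show ?thesis
  proof (rule V.finite_lin_indpt2)
    fix c :: "bit vec \<Rightarrow> bit" assume "V.lincomb c {u, w} = 0\<^sub>v n"
    then have "c u \<cdot>\<^sub>v u + c w \<cdot>\<^sub>v w = 0\<^sub>v n"
      using V.lincomb_pair[OF assms(1-3)] by simp
    then show "\<forall>v\<in>{u, w}. c v = 0"
      using assms bit_vec_add_eq_zero_iff[OF u w] by (cases "c u"; cases "c w") auto
  qed (use u w in auto)
qed

text \<open>A plane is the span of a two-element basis, hence consists of four explicit vectors.
  This replaces the abstract dimension by a list of points.\<close>

lemma bit_plane_subspace_iff:
  "subspace class_ring W (module_vec TYPE(bit) n) \<and>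
     vectorspace.dim class_ring ((module_vec TYPE(bit) n)\<lparr>carrier := W\<rparr>) = 2 \<longleftrightarrow>
   (\<exists>u\<in>carrier_vec n. \<exists>w\<in>carrier_vec n.
      u \<noteq> w \<and> u \<noteq> 0\<^sub>v n \<and> w \<noteq> 0\<^sub>v n \<and> W = {0\<^sub>v n, u, w, u + w})"
    (is "?L \<longleftrightarrow> ?R")
proof -
  interpret V: vec_space "TYPE(bit)" n .
  let ?V = "module_vec TYPE(bit) n"
  show ?thesis
  proof
    assume L: ?L
    then have sub: "subspace class_ring W ?V" by simp
    then have sm: "submodule class_ring W ?V" by (rule V.is_module)
    then have W: "W \<subseteq> carrier_vec n" using submodule.subset by fastforce
    interpret W: vectorspace class_ring "V.vs W" by (rule V.subspace_is_vs[OF sub])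
    \<comment> \<open>Being finite, \<open>W\<close> is a finite generating set of itself, so it has
      a finite basis.\<close>
    have "finite W" using W finite_subset finite_carrier_bit_vec by blast
    then have "W.fin_dim"
      unfolding W.fin_dim_def using W.span_is_subset2[of W] W.in_own_span[of W]
      by (intro exI[of _ W]) auto
    then obtain B where B: "finite B" "W.basis B" using W.finite_basis_exists by blast
    with L have "card B = 2" using W.dim_basis by simp
    then obtain u w where uw: "B = {u, w}" "u \<noteq> w" by (auto simp: card_2_iff)
    from B uw have BW: "{u, w} \<subseteq> W" and gen: "W.span {u, w} = W" and li: "W.lin_indpt {u, w}"
      unfolding W.basis_def by auto
    \<comment> \<open>Span and linear independence of \<open>{u, w}\<close> mean the same in
      \<open>W\<close> as in the ambient space, where they are computed explicitly.\<close>
    note nd = V.span_li_not_depend[OF BW sm]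
    have u: "u \<in> carrier_vec n" and w: "w \<in> carrier_vec n" using BW W by auto
    have "V.span {u, w} = W" using nd gen by simp
    moreover have "V.lin_indpt {u, w}" using nd li by simp
    then have "0\<^sub>v n \<notin> {u, w}" using V.vs_zero_lin_dep[of "{u, w}"] u w by auto
    ultimately show ?R using span_bit_pair[OF u w] uw u w by auto
  next
    assume ?R
    then obtain u w where u: "u \<in> carrier_vec n" and w: "w \<in> carrier_vec n" 
      and ne: "u \<noteq> w" "u \<noteq> 0\<^sub>v n" "w \<noteq> 0\<^sub>v n" and W: "W = {0\<^sub>v n, u, w, u + w}" by auto
    have sp: "V.span {u, w} = W" using span_bit_pair[OF u w] ne W by simp
    then have sub: "subspace class_ring W ?V" using V.span_is_subspace[of "{u, w}"] u w by simp
    then have sm: "submodule class_ring W ?V" by (rule V.is_module)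
    interpret W: vectorspace class_ring "V.vs W" by (rule V.subspace_is_vs[OF sub])
    have BW: "{u, w} \<subseteq> W" using W by auto
    note nd = V.span_li_not_depend[OF BW sm]
    have "W.basis {u, w}" unfolding W.basis_def
      using nd sp BW lin_indpt_bit_pair[OF u w ne] by simp
    then have "W.dim = 2" using W.dim_basis[of "{u, w}"] ne by simp
    with sub show ?L by simp
  qed
qed

section \<open>Character sums and Parseval's identity\<close>

text \<open>The nontrivial additive character of the field, with integer values; its body has the
  form of the summand in \<open>walsh_hadamard\<close>.\<close>

definition bit_sign :: "bit \<Rightarrow> int" where
  "bit_sign b = (- 1) ^ (of_bit b :: nat)"

lemma bit_sign_simps [simp]: "bit_sign 0 = 1" "bit_sign 1 = - 1"
  by (simp_all add: bit_sign_def)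

lemma bit_sign_add: "bit_sign (a + b) = bit_sign a * bit_sign b"
  by (cases a; cases b) auto

text \<open>Orthogonality of characters: each coordinate \<open>b\<close> of \<open>u\<close>
  contributes a factor \<open>1 + bit_sign b\<close>, which is 2 for \<open>b = 0\<close> and 0 for
  \<open>b = 1\<close>.\<close>

lemma sum_bit_sign_scalar_prod:
  fixes u :: "bit vec"
  assumes "u \<in> carrier_vec n"
  shows "(\<Sum>x\<in>carrier_vec n. bit_sign (x \<bullet> u)) = (if u = 0\<^sub>v n then 2 ^ n else 0)"
  using assms
proof (induction n arbitrary: u)
  case 0
  have "carrier_vec 0 = {vNil :: bit vec}" by auto
  with 0 show ?case by simp
next
  case (Suc n)
  then obtain b v where u: "u = vCons b v" "v \<in> carrier_vec n"
    by (cases u) auto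
  have inj: "inj_on (\<lambda>(a, v). vCons a v) (UNIV \<times> carrier_vec n :: (bit \<times> bit vec) set)"
    by (auto simp: inj_on_def)
  have "(\<Sum>x\<in>carrier_vec (Suc n). bit_sign (x \<bullet> u)) =
      (\<Sum>a\<in>UNIV. \<Sum>x\<in>carrier_vec n. bit_sign (a * b) * bit_sign (x \<bullet> v))"
    unfolding carrier_vec_Suc_eq sum.reindex[OF inj] sum.cartesian_product
    by (auto intro!: sum.cong simp: u bit_sign_add)
  also have "\<dots> = (1 + bit_sign b) * (\<Sum>x\<in>carrier_vec n. bit_sign (x \<bullet> v))"
    by (simp add: UNIV_bit sum_distrib_left algebra_simps)
  also have "\<dots> = (if u = 0\<^sub>v (Suc n) then 2 ^ Suc n else 0)"
    using Suc.IH[OF u(2)] by (cases b) (auto simp: u zero_vec_Suc)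
  finally show ?case .
qed

text \<open>Expanding the square gives a sum over pairs \<open>y\<close>, \<open>z\<close> in
  \<open>A\<close>. With the sum over \<open>b\<close> moved inside, orthogonality leaves only the
  pairs with \<open>y + z = 0\<close>, that is, the diagonal, where \<open>h y + h z\<close>
  vanishes too.\<close>

lemma sum_bit_sign_Parseval:
  fixes A :: "bit vec set"
  assumes A: "A \<subseteq> carrier_vec n"
  shows "(\<Sum>b\<in>carrier_vec n. (\<Sum>y\<in>A. bit_sign (h y + b \<bullet> y))\<^sup>2) = 2 ^ n * int (card A)"
proof -
  have fin: "finite A" using A finite_subset finite_carrier_bit_vec by blast
  have "(\<Sum>b\<in>carrier_vec n. (\<Sum>y\<in>A. bit_sign (h y + b \<bullet> y))\<^sup>2) =
      (\<Sum>b\<in>carrier_vec n. \<Sum>y\<in>A. \<Sum>z\<in>A. bit_sign (h y + h z) * bit_sign (b \<bullet> (y + z)))"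
    unfolding power2_eq_square sum_product
    using A by (intro sum.cong refl) (auto simp: scalar_prod_add_distrib[of _ n] subset_iff bit_sign_add mult_ac)
  also have "\<dots> = (\<Sum>y\<in>A. \<Sum>z\<in>A. \<Sum>b\<in>carrier_vec n. bit_sign (h y + h z) * bit_sign (b \<bullet> (y + z)))"
    by (subst (2) sum.swap, subst sum.swap) (simp add: sum.swap[of _ A "carrier_vec n"])
  also have "\<dots> = (\<Sum>y\<in>A. \<Sum>z\<in>A. if z = y then 2 ^ n else 0)"
  proof (intro sum.cong refl)
    fix y z assume "y \<in> A" "z \<in> A"
    then have "y \<in> carrier_vec n" "z \<in> carrier_vec n" using A by auto
    then show "(\<Sum>b\<in>carrier_vec n. bit_sign (h y + h z) * bit_sign (b \<bullet> (y + z))) = (if z = y then 2 ^ n else 0)"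
      unfolding sum_distrib_left[symmetric]
      by (subst sum_bit_sign_scalar_prod) (auto simp: bit_vec_add_eq_zero_iff)
  qed
  also have "\<dots> = 2 ^ n * int (card A)"
    using fin by simp
  finally show ?thesis .
qed

section \<open>Odd weight and affine planes in terms of sums\<close>

text \<open>Bits add modulo 2, so the sum of \<open>h\<close> is the parity of the number of
  ones.\<close>

lemma odd_weight_on_iff:
  assumes "finite S"
  shows "odd (weight_on S h) \<longleftrightarrow> (\<Sum>y\<in>S. h y) = 1"
  using assms
proof (induction S)
  case empty
  then show ?case by (simp add: weight_on_def)
next
  case (insert a S)
  have "{y \<in> insert a S. h y = 1} = (if h a = 1 then insert a {y \<in> S. h y = 1} else {y \<in> S. h y = 1})"
    by auto
  with insert show ?case
    by (cases "h a"; cases "\<Sum>y\<in>S. h y") (auto simp: weight_on_def)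
qed

text \<open>If \<open>k\<close> of the four bits are 1, the signs add up to
  \<open>4 - 2 * k\<close>, which is 2 or -2 exactly for odd \<open>k\<close>.\<close>

lemma sum_four_bit_signs:
  "bit_sign a + bit_sign b + bit_sign c + bit_sign d \<in> {2, - 2} \<longleftrightarrow> a + b + c + d = 1"
  by (cases a; cases b; cases c; cases d) auto

lemma affine_plane_iff:
  fixes A :: "bit vec set"
  shows "affine_subspace n 2 A \<longleftrightarrow>
    (\<exists>v\<in>carrier_vec n. \<exists>u\<in>carrier_vec n. \<exists>w\<in>carrier_vec n.
       u \<noteq> w \<and> u \<noteq> 0\<^sub>v n \<and> w \<noteq> 0\<^sub>v n \<and> A = {v, v + u, v + w, v + (u + w)})"
proof -
  have "affine_subspace n 2 A \<longleftrightarrow> (\<exists>v\<in>carrier_vec n. \<exists>W.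
      (\<exists>u\<in>carrier_vec n. \<exists>w\<in>carrier_vec n.
        u \<noteq> w \<and> u \<noteq> 0\<^sub>v n \<and> w \<noteq> 0\<^sub>v n \<and> W = {0\<^sub>v n, u, w, u + w}) \<and> A = (\<lambda>w. v + w) ` W)"
    unfolding affine_subspace_def bit_plane_subspace_iff[symmetric] by blast
  also have "\<dots> \<longleftrightarrow> (\<exists>v\<in>carrier_vec n. \<exists>u\<in>carrier_vec n. \<exists>w\<in>carrier_vec n.
       u \<noteq> w \<and> u \<noteq> 0\<^sub>v n \<and> w \<noteq> 0\<^sub>v n \<and> A = (\<lambda>w. v + w) ` {0\<^sub>v n, u, w, u + w})"
    by blast
  also have "\<dots> \<longleftrightarrow> (\<exists>v\<in>carrier_vec n. \<exists>u\<in>carrier_vec n. \<exists>w\<in>carrier_vec n.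
       u \<noteq> w \<and> u \<noteq> 0\<^sub>v n \<and> w \<noteq> 0\<^sub>v n \<and> A = {v, v + u, v + w, v + (u + w)})"
    by (intro bex_cong refl) simp
  finally show ?thesis .
qed

text \<open>With base point \<open>p\<close> and directions \<open>p + q\<close> and
  \<open>p + r\<close>, the fourth point of the plane is \<open>p + q + r\<close>. It equals
  \<open>s\<close> exactly when the four points add up to zero.\<close>

lemma affine_plane_iff_sum_zero:
  "affine_subspace n 2 A \<longleftrightarrow>
     (\<exists>p\<in>carrier_vec n. \<exists>q\<in>carrier_vec n. \<exists>r\<in>carrier_vec n. \<exists>s\<in>carrier_vec n.
        distinct [p, q, r, s] \<and> A = {p, q, r, s} \<and> p + q + r + s = 0\<^sub>v n)"
    (is "_ \<longleftrightarrow> ?R")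
proof
  assume "affine_subspace n 2 A"
  then obtain v u w where c: "v \<in> carrier_vec n" "u \<in> carrier_vec n" "w \<in> carrier_vec n"
    and ne: "u \<noteq> w" "u \<noteq> 0\<^sub>v n" "w \<noteq> 0\<^sub>v n" and A: "A = {v, v + u, v + w, v + (u + w)}"
    unfolding affine_plane_iff by blast
  \<comment> \<open>Adding \<open>v\<close> twice changes nothing, so translation by
    \<open>v\<close> is injective.\<close>
  have cancel: "v + x = v + y \<longleftrightarrow> x = y" if "x \<in> carrier_vec n" "y \<in> carrier_vec n" for x y
    using that c bit_vec_add_self_left by metis
  have cancel0: "v = v + x \<longleftrightarrow> x = 0\<^sub>v n" if "x \<in> carrier_vec n" for x
    using cancel[of "0\<^sub>v n" x] that c by auto
  have "u + w \<noteq> 0\<^sub>v n" "u + w \<noteq> u" "u + w \<noteq> w"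
    using ne c bit_vec_add_eq_zero_iff bit_vec_add_self_left[of u n w] bit_vec_add_self_left[of w n u]
    by (auto simp: comm_add_vec[of w n u])
  then have "distinct [v, v + u, v + w, v + (u + w)]"
    using ne c by (simp add: cancel cancel0)
  moreover have "v + (v + u) + (v + w) + (v + (u + w)) = 0\<^sub>v n"
    using c by (intro eq_vecI) (auto simp: add_ac)
  ultimately show ?R
    unfolding A
    by (rule_tac bexI[of _ v], rule_tac bexI[of _ "v + u"], rule_tac bexI[of _ "v + w"],
        rule_tac bexI[of _ "v + (u + w)"]) (simp_all add: c)
next
  assume ?R
  then obtain p q r s where c: "p \<in> carrier_vec n" "q \<in> carrier_vec n" "r \<in> carrier_vec n" "s \<in> carrier_vec n"
    and d: "distinct [p, q, r, s]" and A: "A = {p, q, r, s}" and z: "p + q + r + s = 0\<^sub>v n" by blast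
  have s: "s = p + q + r"
    using z c bit_vec_add_eq_zero_iff[of "p + q + r" n s] by simp
  have "p + (p + q) = q" "p + (p + r) = r" "p + ((p + q) + (p + r)) = s"
    unfolding s using c by (auto intro!: eq_vecI simp: add_ac)
  moreover have "p + q \<noteq> p + r" using d c bit_vec_add_self_left[of p n] by (metis distinct_length_2_or_more)
  moreover have "p + q \<noteq> 0\<^sub>v n" "p + r \<noteq> 0\<^sub>v n"
    using d c bit_vec_add_eq_zero_iff by auto
  ultimately show "affine_subspace n 2 A"
    unfolding affine_plane_iff A using c
    by (rule_tac bexI[of _ p], rule_tac bexI[of _ "p + q"], rule_tac bexI[of _ "p + r"]) auto
qed

lemma affine_plane_odd_weight_iff:
  fixes A :: "bit vec set"
  assumes A: "A \<subseteq> carrier_vec n"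
  shows "affine_subspace n 2 A \<and> odd (weight_on A h) \<longleftrightarrow>
    (\<forall>b\<in>carrier_vec n. (\<Sum>y\<in>A. bit_sign (h y + b \<bullet> y)) \<in> {2, - 2})"
    (is "?L \<longleftrightarrow> ?R")
proof -
  have fin: "finite A" using A finite_subset finite_carrier_bit_vec by blast
  \<comment> \<open>By bilinearity the four exponents add up to the parity of \<open>h\<close> on
    \<open>A\<close> plus one scalar product, so \<open>b\<close> meets the points only through
    their sum.\<close>
  have four: "(\<Sum>y\<in>A. bit_sign (h y + b \<bullet> y)) \<in> {2, - 2} \<longleftrightarrow>
      (\<Sum>y\<in>A. h y) + b \<bullet> (p + q + r + s) = 1"
    if "distinct [p, q, r, s]" "A = {p, q, r, s}" "b \<in> carrier_vec n" for p q r s b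
  proof -
    have c: "p \<in> carrier_vec n" "q \<in> carrier_vec n" "r \<in> carrier_vec n" "s \<in> carrier_vec n"
      using that A by auto
    have "(\<Sum>y\<in>A. bit_sign (h y + b \<bullet> y)) = bit_sign (h p + b \<bullet> p) + bit_sign (h q + b \<bullet> q)
        + bit_sign (h r + b \<bullet> r) + bit_sign (h s + b \<bullet> s)"
      using that by simp
    moreover have "(h p + b \<bullet> p) + (h q + b \<bullet> q) + (h r + b \<bullet> r) + (h s + b \<bullet> s) =
        (\<Sum>y\<in>A. h y) + b \<bullet> (p + q + r + s)"
      using that c by (simp add: scalar_prod_add_distrib[of _ n] add_ac)
    ultimately show ?thesis by (simp only: sum_four_bit_signs)
  qed
  show ?thesis
  proof
    assume ?L
    then obtain p q r s where "distinct [p, q, r, s]" "A = {p, q, r, s}" "p + q + r + s = 0\<^sub>v n"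
      unfolding affine_plane_iff_sum_zero by blast
    with \<open>?L\<close> four[of p q r s] odd_weight_on_iff[OF fin, of h] show ?R by simp
  next
    assume R: ?R
    \<comment> \<open>Every square is 4, so comparison with Parseval's identity fixes the size of
      \<open>A\<close>.\<close>
    have "(\<Sum>b\<in>carrier_vec n. (\<Sum>y\<in>A. bit_sign (h y + b \<bullet> y))\<^sup>2) = (\<Sum>b\<in>(carrier_vec n :: bit vec set). 4)"
      using R by (intro sum.cong refl) fastforce
    \<comment> \<open>The number \<open>2 ^ n\<close> of vectors is the character sum at the zero
      vector.\<close>
    also have "\<dots> = 2 ^ n * 4"
      using sum_bit_sign_scalar_prod[of "0\<^sub>v n" n] by simp
    finally have "card A = 4"
      unfolding sum_bit_sign_Parseval[OF A] by simp
    then obtain p q r s where d: "distinct [p, q, r, s]" and Ae: "A = {p, q, r, s}"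
      by (auto simp: card_Suc_eq numeral_eq_Suc)
    then have c: "p \<in> carrier_vec n" "q \<in> carrier_vec n" "r \<in> carrier_vec n" "s \<in> carrier_vec n"
      using A by auto
    define t where "t = p + q + r + s"
    have t: "t \<in> carrier_vec n" using c by (simp add: t_def)
    have all: "(\<Sum>y\<in>A. h y) + b \<bullet> t = 1" if "b \<in> carrier_vec n" for b
      using four[OF d Ae that] R that unfolding t_def by blast
    \<comment> \<open>The choice \<open>b = 0\<close> isolates the parity of
      \<open>h\<close>.\<close>
    from all[of "0\<^sub>v n"] t have h: "(\<Sum>y\<in>A. h y) = 1" by simp
    have "t = 0\<^sub>v n"
    proof (rule eq_vecI)
      fix i assume i: "i < dim_vec (0\<^sub>v n :: bit vec)"
      \<comment> \<open>A unit vector reads off one coordinate of \<open>t\<close>, which must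
        vanish since the parity of \<open>h\<close> is already 1.\<close>
      with all[of "unit_vec n i"] h t have "1 + t $ i = 1" by simp
      with i show "t $ i = 0\<^sub>v n $ i" by (cases "t $ i") auto
    qed (use t in auto)
    with d Ae c have "affine_subspace n 2 A"
      unfolding affine_plane_iff_sum_zero t_def by blast
    with h show ?L using odd_weight_on_iff[OF fin] by simp
  qed
qed

section \<open>The Walsh-Hadamard transform as a sum over a fiber\<close>

lemma sum_carrier_vec_append:
  fixes g :: "'a vec \<Rightarrow> 'b :: comm_monoid_add"
  shows "(\<Sum>z\<in>carrier_vec (k + l). g z) = (\<Sum>x\<in>carrier_vec k. \<Sum>y\<in>carrier_vec l. g (x @\<^sub>v y))"
proof -
  have parts: "vec_first (x @\<^sub>v y) k = x" "vec_last (x @\<^sub>v y) l = y"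
    if "x \<in> carrier_vec k" "y \<in> carrier_vec l" for x y :: "'a vec"
    using that by (auto simp: vec_first_def vec_last_def)
  have "(\<Sum>z\<in>carrier_vec (k + l). g z) = (\<Sum>(x, y)\<in>carrier_vec k \<times> carrier_vec l. g (x @\<^sub>v y))"
    by (rule sum.reindex_bij_witness[where i = "\<lambda>(x, y). x @\<^sub>v y" and j = "\<lambda>z. (vec_first z k, vec_last z l)"])
      (auto simp: parts)
  then show ?thesis by (simp add: sum.cartesian_product)
qed

text \<open>For fixed \<open>y\<close> the variable \<open>x\<close> enters only through
  \<open>x \<bullet> (\<phi> y + a)\<close>. Summing over \<open>x\<close> gives
  \<open>2 ^ k\<close> if \<open>\<phi> y = a\<close> and 0 otherwise.\<close>

lemma walsh_hadamard_append:
  assumes \<phi>: "\<phi> \<in> carrier_vec l \<rightarrow> carrier_vec k"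
    and f: "\<And>x y. x \<in> carrier_vec k \<Longrightarrow> y \<in> carrier_vec l \<Longrightarrow> f (x @\<^sub>v y) = x \<bullet> \<phi> y + h y"
    and a: "a \<in> carrier_vec k" and b: "b \<in> carrier_vec l"
  shows "walsh_hadamard (k + l) f (a @\<^sub>v b) = 2 ^ k * (\<Sum>y\<in>fiber l \<phi> a. bit_sign (h y + b \<bullet> y))"
proof -
  have "walsh_hadamard (k + l) f (a @\<^sub>v b) =
      (\<Sum>x\<in>carrier_vec k. \<Sum>y\<in>carrier_vec l. bit_sign (h y + b \<bullet> y) * bit_sign (x \<bullet> (\<phi> y + a)))"
    unfolding walsh_hadamard_def sum_carrier_vec_append bit_sign_def[symmetric]
  proof (intro sum.cong refl)
    fix x y :: "bit vec" assume x: "x \<in> carrier_vec k" and y: "y \<in> carrier_vec l"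
    have "\<phi> y \<in> carrier_vec k" using \<phi> y by blast
    then have "f (x @\<^sub>v y) + (a @\<^sub>v b) \<bullet> (x @\<^sub>v y) = (h y + b \<bullet> y) + x \<bullet> (\<phi> y + a)"
      using f[OF x y] x y a b
      by (simp add: scalar_prod_append scalar_prod_add_distrib[of _ k] comm_scalar_prod[of a k x] add_ac)
    then show "bit_sign (f (x @\<^sub>v y) + (a @\<^sub>v b) \<bullet> (x @\<^sub>v y)) = bit_sign (h y + b \<bullet> y) * bit_sign (x \<bullet> (\<phi> y + a))"
      by (simp only: bit_sign_add)
  qed
  also have "\<dots> = (\<Sum>y\<in>carrier_vec l. bit_sign (h y + b \<bullet> y) * (\<Sum>x\<in>carrier_vec k. bit_sign (x \<bullet> (\<phi> y + a))))"
    by (subst sum.swap) (simp add: sum_distrib_left)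
  also have "\<dots> = (\<Sum>y\<in>carrier_vec l. if \<phi> y = a then 2 ^ k * bit_sign (h y + b \<bullet> y) else 0)"
  proof (intro sum.cong refl)
    fix y :: "bit vec" assume "y \<in> carrier_vec l"
    then have "\<phi> y \<in> carrier_vec k" using \<phi> by blast
    with a show "bit_sign (h y + b \<bullet> y) * (\<Sum>x\<in>carrier_vec k. bit_sign (x \<bullet> (\<phi> y + a))) =
        (if \<phi> y = a then 2 ^ k * bit_sign (h y + b \<bullet> y) else 0)"
      by (simp add: sum_bit_sign_scalar_prod bit_vec_add_eq_zero_iff)
  qed
  also have "\<dots> = (\<Sum>y\<in>fiber l \<phi> a. 2 ^ k * bit_sign (h y + b \<bullet> y))"
    unfolding fiber_def by (intro sum.inter_filter[symmetric]) simp
  finally show ?thesis by (simp add: sum_distrib_left)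
qed

section \<open>Fibers as a partition and the final equivalence\<close>

text \<open>A linear subspace contains zero, so its translate contains the base point.\<close>

lemma affine_subspace_nonempty: "affine_subspace n d A \<Longrightarrow> A \<noteq> {}"
  unfolding affine_subspace_def subspace_def using submodule.zero_closed by fastforce

text \<open>Fibers over different values are disjoint and together cover the domain, so what remains
  of the partition property is surjectivity of \<open>\<phi>\<close>.\<close>

lemma partition_on_fibers_iff:
  assumes "\<phi> \<in> carrier_vec l \<rightarrow> carrier_vec k"
  shows "partition_on (carrier_vec l) {fiber l \<phi> a | a. a \<in> carrier_vec k} \<longleftrightarrow>
    (\<forall>a\<in>carrier_vec k. fiber l \<phi> a \<noteq> {})"
  using assms unfolding partition_on_def disjoint_def fiber_def by auto

theorem theorem3p1:
  fixes m n :: nat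
    and f h :: "bit vec \<Rightarrow> bit"
    and \<phi> :: "bit vec \<Rightarrow> bit vec"
  assumes "m > 0"
    and "n = 2 * m"
    and "\<phi> \<in> carrier_vec (m + 1) \<rightarrow> carrier_vec (m - 1)"
    and "\<And>x y. x \<in> carrier_vec (m - 1) \<Longrightarrow> y \<in> carrier_vec (m + 1) \<Longrightarrow>
           f (x @\<^sub>v y) = x \<bullet> \<phi> y + h y"
  shows "bent n f \<longleftrightarrow>
    (partition_on (carrier_vec (m + 1)) {fiber (m + 1) \<phi> a | a. a \<in> carrier_vec (m - 1)} \<and>
     (\<forall>a\<in>carrier_vec (m - 1). affine_subspace (m + 1) 2 (fiber (m + 1) \<phi> a))) \<and>
    (\<forall>a\<in>carrier_vec (m - 1). odd (weight_on (fiber (m + 1) \<phi> a) h))"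
proof -
  let ?S = "\<lambda>a b. \<Sum>y\<in>fiber (m + 1) \<phi> a. bit_sign (h y + b \<bullet> y)"
  \<comment> \<open>As \<open>m > 0\<close>, the bent value \<open>2 ^ m\<close> is
    \<open>2 ^ (m - 1) * 2\<close>. The factor \<open>2 ^ (m - 1)\<close> of the transform then
    cancels, leaving 2 or -2 for \<open>?S a b\<close>.\<close>
  have n: "n = (m - 1) + (m + 1)" and pow: "(2 :: int) ^ (n div 2) = 2 ^ (m - 1) * 2"
    using assms(1,2) by (simp_all flip: power_Suc2)
  have "bent n f \<longleftrightarrow> (\<forall>\<omega>\<in>carrier_vec ((m - 1) + (m + 1)).
      walsh_hadamard ((m - 1) + (m + 1)) f \<omega> \<in> {2 ^ (m - 1) * 2, - (2 ^ (m - 1) * 2)})"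
    unfolding bent_def pow using assms(2) n by simp
  also have "\<dots> \<longleftrightarrow> (\<forall>a\<in>carrier_vec (m - 1). \<forall>b\<in>carrier_vec (m + 1). ?S a b \<in> {2, - 2})"
    unfolding all_vec_append[of "m - 1" "m + 1"]
  proof (intro ball_cong refl)
    fix a b :: "bit vec" assume "a \<in> carrier_vec (m - 1)" "b \<in> carrier_vec (m + 1)"
    then have "walsh_hadamard ((m - 1) + (m + 1)) f (a @\<^sub>v b) = 2 ^ (m - 1) * ?S a b"
      by (intro walsh_hadamard_append assms(3,4))
    moreover have "(c * s \<in> {c * 2, - (c * 2)}) = (s \<in> {2, - 2})" if "c \<noteq> 0" for c s :: int
      using that by (auto simp flip: mult_minus_right)
    ultimately show "(walsh_hadamard ((m - 1) + (m + 1)) f (a @\<^sub>v b) \<in> {2 ^ (m - 1) * 2, - (2 ^ (m - 1) * 2)})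
        = (?S a b \<in> {2, - 2})"
      by simp
  qed
  also have "\<dots> \<longleftrightarrow> (\<forall>a\<in>carrier_vec (m - 1).
      affine_subspace (m + 1) 2 (fiber (m + 1) \<phi> a) \<and> odd (weight_on (fiber (m + 1) \<phi> a) h))"
    by (intro ball_cong refl affine_plane_odd_weight_iff[symmetric]) (auto simp: fiber_def)
  finally show ?thesis
    unfolding partition_on_fibers_iff[OF assms(3)] using affine_subspace_nonempty by blast
qed

end
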